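(* Let $G$ be a finite connected regular simple graph on $N$ vertices. For any FAT $k$-coloring of $G$, all coloring classes have the same size. In particular, each class has size $N/k$, and therefore $k$ divides $N$.
   Context: For $v\in V$ and $S\subseteq V$, let $e(v,S)$ denote the number of neighbors of $v$ in $S$. A vertex $k$-coloring of $G$ is a function $c:V\to\{1,\ldots,k\}$ with coloring classes $V_i=c^{-1}(i)$. It is Fair and Tolerant (FAT) if there exists $\alpha\in[0,1]$ such that, with $\beta:=1-(k-1)\alpha$, for every vertex $v$ and every $i$ we have $e(v,V_i)=\alpha\deg v$ if $v\notin V_i$ and $e(v,V_i)=\beta\deg v$ if $v\in V_i$.
   Formalization: The formal theorem also assumes that all k coloring classes are nonempty; without this the claim fails, e.g. for k = 2, α = 0 and the constant coloring, whose classes have sizes N and 0. Every excluded case violates the claim. *)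

theory Defs
  imports Complex_Main "Graph_Theory.Digraph_Component"
begin

text \<open>
  A finite simple graph is a \<open>graph\<close> of the Graph Theory entry: a finite, symmetric, loop-free
  digraph without parallel arcs. Each undirected edge is represented by two opposite arcs, so
  \<^const>\<open>out_degree\<close> is the usual degree. The library's \<^const>\<open>connected\<close> excludes the empty graph.
\<close>

definition regular :: "('a, 'b) pre_digraph \<Rightarrow> bool" where
  "regular G \<longleftrightarrow> (\<exists>d. \<forall>v\<in>verts G. out_degree G v = d)"

definition nbrs_in :: "('a, 'b) pre_digraph \<Rightarrow> 'a \<Rightarrow> 'a set \<Rightarrow> nat" where
  "nbrs_in G v S = card {w \<in> S. v \<rightarrow>\<^bsub>G\<^esub> w}"

definition vertex_coloring :: "('a, 'b) pre_digraph \<Rightarrow> nat \<Rightarrow> ('a \<Rightarrow> nat) \<Rightarrow> bool" where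
  "vertex_coloring G k c \<longleftrightarrow> c ` verts G \<subseteq> {1..k}"

definition color_class :: "('a, 'b) pre_digraph \<Rightarrow> ('a \<Rightarrow> nat) \<Rightarrow> nat \<Rightarrow> 'a set" where
  "color_class G c i = {v \<in> verts G. c v = i}"

definition fat_coloring :: "('a, 'b) pre_digraph \<Rightarrow> nat \<Rightarrow> ('a \<Rightarrow> nat) \<Rightarrow> bool" where
  "fat_coloring G k c \<longleftrightarrow> vertex_coloring G k c \<and>
     (\<exists>\<alpha>::real. 0 \<le> \<alpha> \<and> \<alpha> \<le> 1 \<and>
       (let \<beta> = 1 - (real k - 1) * \<alpha> in
         \<forall>v\<in>verts G. \<forall>i\<in>{1..k}.
           (v \<notin> color_class G c i \<longrightarrow>
              real (nbrs_in G v (color_class G c i)) = \<alpha> * real (out_degree G v)) \<and>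
           (v \<in> color_class G c i \<longrightarrow>
              real (nbrs_in G v (color_class G c i)) = \<beta> * real (out_degree G v))))"

end

theory Submission
  imports Defs
begin

text \<open>
  Counting the edges between two classes from either side gives
  \<open>|V\<^sub>i| \<alpha> d = |V\<^sub>j| \<alpha> d\<close>. If \<open>\<alpha> d \<noteq> 0\<close>, the classes have equal size. If \<open>\<alpha> d = 0\<close>, no edge
  leaves a class, so connectedness leaves room for a single class.
\<close>

text \<open>Double counting: arcs are symmetric, so each side counts the pairs \<open>(v, w)\<close>
  in \<open>A\<close> times \<open>B\<close> with \<open>v\<close> adjacent to
  \<open>w\<close>.\<close>

lemma (in graph) sum_nbrs_in_swap:
  assumes "A \<subseteq> verts G" and "B \<subseteq> verts G"
  shows "(\<Sum>v\<in>A. nbrs_in G v B) = (\<Sum>w\<in>B. nbrs_in G w A)"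
proof -
  have fin: "finite A" "finite B"
    using assms finite_verts by (auto intro: finite_subset)
  have "u \<rightarrow> v \<longleftrightarrow> v \<rightarrow> u" for u v
    using sym_arcs by (auto simp: symmetric_def dest: symD)
  then show ?thesis
    unfolding nbrs_in_def by (intro sum_multicount_gen fin) auto
qed

text \<open>Symmetry of the arcs turns connectedness into a directed walk from \<open>u\<close> to
  \<open>v\<close>, and \<open>f\<close> keeps its value along each arc of it. Used below with the
  coloring as \<open>f\<close>.\<close>

lemma (in graph) connected_constant:
  assumes "connected G"
    and step: "\<And>u v. u \<rightarrow> v \<Longrightarrow> f u = f v"
    and "u \<in> verts G" and "v \<in> verts G"
  shows "f u = f v"
proof -
  have "u \<rightarrow>\<^sup>* v"
    using symmetric_connected_imp_strongly_connected[OF sym_arcs] assms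
    by (auto simp: strongly_connected_def)
  then show ?thesis
    by (induct rule: reachable_induct) (auto dest: step)
qed

lemma (in graph) fat_coloring_card_eq:
  assumes con: "connected G" and reg: "regular G" and fat: "fat_coloring G k c"
    and i: "i \<in> {1..k}" "color_class G c i \<noteq> {}"
    and j: "j \<in> {1..k}" "color_class G c j \<noteq> {}"
  shows "card (color_class G c i) = card (color_class G c j)"
proof (cases "i = j")
  case False
  obtain d where d: "\<And>v. v \<in> verts G \<Longrightarrow> out_degree G v = d"
    using reg by (auto simp: regular_def)
  obtain \<alpha> :: real where "\<forall>v\<in>verts G. \<forall>l\<in>{1..k}. v \<notin> color_class G c l \<longrightarrow>
      real (nbrs_in G v (color_class G c l)) = \<alpha> * real (out_degree G v)"
    using fat unfolding fat_coloring_def Let_def by blast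
  then have \<alpha>: "real (nbrs_in G v (color_class G c l)) = \<alpha> * real d"
    if "v \<in> verts G" "l \<in> {1..k}" "v \<notin> color_class G c l" for v l
    using d that by simp
  have col: "c v \<in> {1..k}" if "v \<in> verts G" for v
    using fat that by (auto simp: fat_coloring_def vertex_coloring_def)
  have "\<alpha> * real d \<noteq> 0"
  proof
    assume zero: "\<alpha> * real d = 0"
    have "c u = c v" if "u \<rightarrow> v" for u v
    proof (rule ccontr)
      assume ne: "c u \<noteq> c v"
      have uv: "u \<in> verts G" "v \<in> verts G"
        using that adj_in_verts by auto
      \<comment> \<open>The class of \<open>v\<close> does not contain \<open>u\<close>, so the
        \<alpha> condition leaves \<open>u\<close> no neighbor there; yet \<open>v\<close> is one.
        Finiteness is what lets cardinality 0 mean empty.\<close>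
      have "nbrs_in G u (color_class G c (c v)) = 0"
        using \<alpha>[OF uv(1) col[OF uv(2)]] ne zero by (auto simp: color_class_def)
      moreover have "finite {w \<in> color_class G c (c v). u \<rightarrow> w}"
        by (simp add: color_class_def)
      moreover have "v \<in> {w \<in> color_class G c (c v). u \<rightarrow> w}"
        using that uv by (simp add: color_class_def)
      ultimately show False
        by (auto simp: nbrs_in_def)
    qed
    then have "c u = c v" if "u \<in> verts G" "v \<in> verts G" for u v
      using connected_constant[OF con, of c] that by blast
    moreover obtain u v where "u \<in> color_class G c i" "v \<in> color_class G c j"
      using i(2) j(2) by blast
    ultimately show False
      using False by (auto simp: color_class_def)
  qed
  \<comment> \<open>As \<open>i\<close> and \<open>j\<close> differ, each vertex of one class lies
    outside the other, so every summand is \<open>\<alpha> * real d\<close>.\<close>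
  moreover have "real (\<Sum>v\<in>color_class G c i. nbrs_in G v (color_class G c j))
      = real (card (color_class G c i)) * (\<alpha> * real d)"
    using \<alpha>[OF _ j(1)] False by (simp add: color_class_def)
  moreover have "real (\<Sum>v\<in>color_class G c j. nbrs_in G v (color_class G c i))
      = real (card (color_class G c j)) * (\<alpha> * real d)"
    using \<alpha>[OF _ i(1)] False by (simp add: color_class_def)
  moreover have "color_class G c i \<subseteq> verts G" "color_class G c j \<subseteq> verts G"
    by (auto simp: color_class_def)
  ultimately show ?thesis
    using sum_nbrs_in_swap[of "color_class G c i" "color_class G c j"] by simp
qed simp

lemma (in graph) card_verts_eq_sum_color_class:
  assumes "vertex_coloring G k c"
  shows "card (verts G) = (\<Sum>i\<in>{1..k}. card (color_class G c i))"
proof -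
  have "verts G = (\<Union>i\<in>{1..k}. color_class G c i)"
    using assms by (auto simp: vertex_coloring_def color_class_def)
  also have "card \<dots> = (\<Sum>i\<in>{1..k}. card (color_class G c i))"
    by (rule card_UN_disjoint) (auto simp: color_class_def)
  finally show ?thesis .
qed

text \<open>Nonempty classes are assumed because a constant coloring with \<alpha> = 0 satisfies
  \<open>fat_coloring\<close> for every \<open>k\<close> \<ge> 1, leaving all other classes
  empty.\<close>

theorem theorem2p12:
  fixes G :: "('a, 'b) pre_digraph" and N k :: nat and c :: "'a \<Rightarrow> nat"
  assumes "graph G" and "connected G" and "regular G" and "card (verts G) = N"
    and "fat_coloring G k c"
    and all_colors_used: "\<forall>i\<in>{1..k}. color_class G c i \<noteq> {}"
  shows "(\<forall>i\<in>{1..k}. \<forall>j\<in>{1..k}. card (color_class G c i) = card (color_class G c j)) \<and>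
         (\<forall>i\<in>{1..k}. real (card (color_class G c i)) = real N / real k) \<and>
         k dvd N"
proof -
  interpret graph G by fact
  have eq: "card (color_class G c i) = card (color_class G c j)"
    if "i \<in> {1..k}" "j \<in> {1..k}" for i j
    using fat_coloring_card_eq[OF assms(2,3,5)] all_colors_used that by blast
  have col: "vertex_coloring G k c"
    using assms(5) by (simp add: fat_coloring_def)
  have N: "N = k * card (color_class G c i)" if "i \<in> {1..k}" for i
  proof -
    have "N = (\<Sum>j\<in>{1..k}. card (color_class G c i))"
      unfolding assms(4)[symmetric] card_verts_eq_sum_color_class[OF col]
      by (rule sum.cong[OF refl]) (rule eq[OF _ that])
    then show ?thesis by simp
  qed
  \<comment> \<open>A connected graph has a vertex; its color is an index in \<open>{1..k}\<close>
    at which \<open>N\<close> can be applied.\<close>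
  obtain v where "v \<in> verts G"
    using symmetric_connected_imp_strongly_connected[OF sym_arcs assms(2)]
    by (auto simp: strongly_connected_def)
  then have "c v \<in> {1..k}"
    using col by (auto simp: vertex_coloring_def)
  then have "k dvd N"
    by (subst N) auto
  \<comment> \<open>The index \<open>i\<close> forces \<open>k\<close> > 0, so the factor
    \<open>k\<close> cancels.\<close>
  moreover have "real (card (color_class G c i)) = real N / real k" if "i \<in> {1..k}" for i
    using that by (subst N[OF that]) simp
  ultimately show ?thesis
    using eq by blast
qed

end
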